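(* Let $\pi$ (target) and $p$ (proposal) be continuous probability densities on a general state space $\mathcal X$ ($\mathbb R^d$ or a subset of it), with $\operatorname{supp}(\pi)\subset\operatorname{supp}(p)$, let $w=\pi/p$, and suppose $w^\star=\sup_x w(x)<\infty$. Let $P$ be the transition kernel of the Independent Metropolis-Hastings (IMH) chain with target $\pi$ and proposal $p$. Assume that one of the following two conditions holds: (1) $w^\star=w(x^\star)$ for some $x^\star\in\mathcal X$, and both $p$ and $\pi$ are locally Lipschitz; (2) both $\pi$ and $w$ are Lipschitz continuous, and there exist a sequence $\{x_k\}_{k=1}^\infty$ in $\mathcal X$ and a constant $c_0>0$ such that $\lim_{k\to\infty}w(x_k)=w^\star$ and $\pi(x_k)\ge c_0$ for every $k$. Then for every $x\in\operatorname{supp}(\pi)$ the limit $r(x)=\lim_{n\to\infty}\|P^n(x,\cdot)-\pi\|_{\mathrm{TV}}^{1/n}$ exists and $$r(x)=\liminf_{n\to\infty}\|P^n(x,\cdot)-\pi\|_{\mathrm{TV}}^{1/n}=\limsup_{n\to\infty}\|P^n(x,\cdot)-\pi\|_{\mathrm{TV}}^{1/n}=1-\frac1{w^\star}.$$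
   Context: The general state space $\mathcal X$ is $\mathbb R^d$ or a subset of $\mathbb R^d$ (a Polish space), with its Borel $\sigma$-algebra; densities are with respect to Lebesgue measure $dy$, and $\pi$ also denotes the probability measure with density $\pi$. Here $\operatorname{supp}(f)=\{x\in\mathcal X: f(x)>0\}$. The weight function is $w(x)=\pi(x)/p(x)$ for $x\in\operatorname{supp}(p)$, and $w^\star=\sup_{x}w(x)$. The IMH chain: from the current state $x\in\operatorname{supp}(\pi)$, draw $y\sim p$ (independently of $x$) and move to $y$ with probability $\min\{w(y)/w(x),1\}$, otherwise stay at $x$. Its kernel is, for $x\in\operatorname{supp}(\pi)$ and measurable $A$, $$P(x,A)=\int_A \min\Big\{\frac{w(y)}{w(x)},1\Big\}p(y)\,dy+R(x)\mathbf 1_A(x),\qquad R(x)=\int_{\mathcal X}\Big(1-\min\Big\{\frac{w(y)}{w(x)},1\Big\}\Big)p(y)\,dy .$$ The chain is always started in (and then stays almost surely in) $\operatorname{supp}(\pi)$. $P^n$ is the $n$-step kernel, and $\|\mu-\nu\|_{\mathrm{TV}}=\sup_A|\mu(A)-\nu(A)|$.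
   Formalization: Added: every nonempty relatively open subset of the state space inside supp(π) has positive Lebesgue measure (automatic on R^d). Otherwise false: on [0,1]∪{2} with p=1, π=1 on [0,1], π(2)=2, one has w*=2 but r(x)=0 for x in [0,1]. *)

theory Defs
  imports "HOL-Probability.Probability"
begin

definition polish_space :: "'a topology \<Rightarrow> bool" where
  "polish_space T \<longleftrightarrow> completely_metrizable_space T \<and> separable_space T"

definition locally_lipschitz_on :: "'a::metric_space set \<Rightarrow> ('a \<Rightarrow> 'b::metric_space) \<Rightarrow> bool" where
  "locally_lipschitz_on X f \<longleftrightarrow> (\<forall>x\<in>X. \<exists>u>0. \<exists>L. L-lipschitz_on (cball x u \<inter> X) f)"

definition leb_on :: "'a::euclidean_space set \<Rightarrow> 'a measure" where
  "leb_on X = restrict_space lborel X"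

text \<open>Only the values on the state space matter. The support is the positivity set, without closure.\<close>

definition supp_on :: "'a set \<Rightarrow> ('a \<Rightarrow> real) \<Rightarrow> 'a set" where
  "supp_on X f = {x \<in> X. f x > 0}"

definition law_on :: "'a::euclidean_space set \<Rightarrow> ('a \<Rightarrow> real) \<Rightarrow> 'a measure" where
  "law_on X f = density (leb_on X) (\<lambda>x. ennreal (f x))"

definition cont_prob_density_on :: "'a::euclidean_space set \<Rightarrow> ('a \<Rightarrow> real) \<Rightarrow> bool" where
  "cont_prob_density_on X f \<longleftrightarrow>
     continuous_on X f \<and> (\<forall>x\<in>X. 0 \<le> f x) \<and> prob_space (law_on X f)"

definition imh_weight :: "('a \<Rightarrow> real) \<Rightarrow> ('a \<Rightarrow> real) \<Rightarrow> 'a \<Rightarrow> real" where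
  "imh_weight \<pi> p x = \<pi> x / p x"

definition imh_wstar :: "'a set \<Rightarrow> ('a \<Rightarrow> real) \<Rightarrow> ('a \<Rightarrow> real) \<Rightarrow> real" where
  "imh_wstar X \<pi> p = (SUP x\<in>supp_on X p. imh_weight \<pi> p x)"

definition imh_accept :: "('a \<Rightarrow> real) \<Rightarrow> ('a \<Rightarrow> real) \<Rightarrow> 'a \<Rightarrow> 'a \<Rightarrow> real" where
  "imh_accept \<pi> p x y = min (imh_weight \<pi> p y / imh_weight \<pi> p x) 1"

definition imh_reject :: "'a::euclidean_space set \<Rightarrow> ('a \<Rightarrow> real) \<Rightarrow> ('a \<Rightarrow> real) \<Rightarrow> 'a \<Rightarrow> real" where
  "imh_reject X \<pi> p x = (\<integral>y. (1 - imh_accept \<pi> p x y) * p y \<partial>leb_on X)"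

text \<open>
  The chain lives in the support of the target. At a state \<open>x\<close> outside it, the convention
  \<open>a / 0 = 0\<close> makes every acceptance probability \<open>0\<close>, so the kernel there is the point
  mass at \<open>x\<close>; this only serves to make it a total Markov kernel on \<open>X\<close>, since a
  chain started in the support never accepts a move out of it.
\<close>

definition imh_kernel :: "'a::euclidean_space set \<Rightarrow> ('a \<Rightarrow> real) \<Rightarrow> ('a \<Rightarrow> real) \<Rightarrow> 'a \<Rightarrow> 'a measure" where
  "imh_kernel X \<pi> p x = measure_of X (sets (leb_on X))
     (\<lambda>A. (\<integral>\<^sup>+y\<in>A. ennreal (imh_accept \<pi> p x y * p y) \<partial>leb_on X)
          + ennreal (imh_reject X \<pi> p x) * indicator A x)"

primrec imh_steps ::
  "'a::euclidean_space set \<Rightarrow> ('a \<Rightarrow> real) \<Rightarrow> ('a \<Rightarrow> real) \<Rightarrow> nat \<Rightarrow> 'a \<Rightarrow> 'a measure" where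
  "imh_steps X \<pi> p 0 x = return (leb_on X) x"
| "imh_steps X \<pi> p (Suc n) x = imh_steps X \<pi> p n x \<bind> imh_kernel X \<pi> p"

text \<open>For two probability measures on the same \<open>\<sigma>\<close>-algebra.\<close>

definition tv_dist :: "'a measure \<Rightarrow> 'a measure \<Rightarrow> real" where
  "tv_dist M N = (SUP A\<in>sets M. \<bar>measure M A - measure N A\<bar>)"

lemma space_leb_on [simp]: "space (leb_on X) = X"
  by (simp add: leb_on_def space_restrict_space)

lemma polish_imp_borel:
  fixes X :: "'a::euclidean_space set"
  assumes "polish_space (top_of_set X)"
  shows "X \<in> sets borel"
proof -
  have "gdelta_in euclidean X"
    using assms by (intro completely_metrizable_space_imp_gdelta_in)
      (auto simp: polish_space_def metrizable_space_euclidean)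
  then obtain U where U: "countable U" "\<And>S. S \<in> U \<Longrightarrow> open S" "X = \<Inter>U"
    by (auto simp: gdelta_in_alt intersection_of_def)
  have "(\<Inter>S\<in>U. S) \<in> sets borel"
    using U(1,2) by (intro sets.countable_INT'') auto
  then show ?thesis
    using U(3) by simp
qed

locale imh =
  fixes X :: "'a::euclidean_space set" and \<pi> p :: "'a \<Rightarrow> real"
  assumes X_borel: "X \<in> sets borel"
    and dens_\<pi>: "cont_prob_density_on X \<pi>"
    and dens_p: "cont_prob_density_on X p"
begin

lemma measurable_cont [measurable (raw)]:
  assumes "continuous_on X (f :: 'a \<Rightarrow> real)" shows "f \<in> borel_measurable (leb_on X)"
  unfolding leb_on_def using borel_measurable_continuous_on_restrict[OF assms]
  by (simp cong: measurable_cong_sets sets_restrict_space_cong)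

lemma meas [measurable]: "\<pi> \<in> borel_measurable (leb_on X)" "p \<in> borel_measurable (leb_on X)"
  using dens_\<pi> dens_p by (auto simp: cont_prob_density_on_def intro: measurable_cont)

lemma nonneg: "x \<in> X \<Longrightarrow> 0 \<le> \<pi> x" "x \<in> X \<Longrightarrow> 0 \<le> p x"
  using dens_\<pi> dens_p by (auto simp: cont_prob_density_on_def)

lemma accept_range: "x \<in> X \<Longrightarrow> y \<in> X \<Longrightarrow> imh_accept \<pi> p x y \<in> {0..1}"
  using nonneg by (auto simp: imh_accept_def imh_weight_def)

lemma accept_meas [measurable]:
  "(\<lambda>(x, y). imh_accept \<pi> p x y) \<in> borel_measurable (leb_on X \<Otimes>\<^sub>M leb_on X)"
  unfolding imh_accept_def imh_weight_def by measurable

lemma p_mass: "(\<integral>\<^sup>+y. ennreal (p y) \<partial>leb_on X) = 1"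
proof -
  interpret prob_space "law_on X p" using dens_p by (simp add: cont_prob_density_on_def)
  have "emeasure (law_on X p) X = 1" using emeasure_space_1 by (simp add: law_on_def)
  also have "emeasure (law_on X p) X = (\<integral>\<^sup>+y. ennreal (p y) * indicator X y \<partial>leb_on X)"
    unfolding law_on_def using sets.top[of "leb_on X"] by (subst emeasure_density) auto
  also have "\<dots> = (\<integral>\<^sup>+y. ennreal (p y) \<partial>leb_on X)"
    by (intro nn_integral_cong) auto
  finally show ?thesis by simp
qed

lemma reject_nn:
  assumes x: "x \<in> X"
  shows "ennreal (imh_reject X \<pi> p x) = (\<integral>\<^sup>+y. ennreal ((1 - imh_accept \<pi> p x y) * p y) \<partial>leb_on X)"
proof -
  have m[measurable]: "(\<lambda>y. imh_accept \<pi> p x y) \<in> borel_measurable (leb_on X)"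
    unfolding imh_accept_def imh_weight_def by measurable
  have ip: "integrable (leb_on X) p"
    using p_mass nonneg by (intro integrableI_nonneg) (auto intro: AE_I2)
  have "integrable (leb_on X) (\<lambda>y. (1 - imh_accept \<pi> p x y) * p y)"
    using accept_range[OF x] nonneg
    by (intro Bochner_Integration.integrable_bound[OF ip])
      (auto intro!: AE_I2 mult_left_le_one_le simp: abs_mult)
  then show ?thesis
    unfolding imh_reject_def using accept_range[OF x] nonneg
    by (intro nn_integral_eq_integral[symmetric]) (auto intro!: AE_I2)
qed

lemma sets_imh_kernel [simp]: "sets (imh_kernel X \<pi> p x) = sets (leb_on X)"
  unfolding imh_kernel_def using sets.space_closed[of "leb_on X"] sets.sigma_sets_eq[of "leb_on X"]
  by (simp add: sets_measure_of)

lemma space_imh_kernel [simp]: "space (imh_kernel X \<pi> p x) = X"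
  using sets_eq_imp_space_eq[OF sets_imh_kernel] by simp

lemma emeasure_imh_kernel:
  assumes x: "x \<in> X" and A: "A \<in> sets (leb_on X)"
  shows "emeasure (imh_kernel X \<pi> p x) A =
     (\<integral>\<^sup>+y\<in>A. ennreal (imh_accept \<pi> p x y * p y) \<partial>leb_on X)
          + ennreal (imh_reject X \<pi> p x) * indicator A x"
proof -
  have m[measurable]: "(\<lambda>y. imh_accept \<pi> p x y) \<in> borel_measurable (leb_on X)"
    unfolding imh_accept_def imh_weight_def by measurable
  let ?D = "density (leb_on X) (\<lambda>y. ennreal (imh_accept \<pi> p x y * p y))"
  let ?R = "scale_measure (ennreal (imh_reject X \<pi> p x)) (return (leb_on X) x)"
  let ?\<mu> = "\<lambda>A. (\<integral>\<^sup>+y\<in>A. ennreal (imh_accept \<pi> p x y * p y) \<partial>leb_on X)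
          + ennreal (imh_reject X \<pi> p x) * indicator A x"
  have eq: "?\<mu> B = emeasure ?D B + emeasure ?R B" if "B \<in> sets (leb_on X)" for B
    using that by (simp add: emeasure_density)
  have "countably_additive (sets (leb_on X)) ?\<mu>"
    unfolding countably_additive_def
  proof safe
    fix B :: "nat \<Rightarrow> 'a set"
    assume B: "range B \<subseteq> sets (leb_on X)" "disjoint_family B" "\<Union> (range B) \<in> sets (leb_on X)"
    have "(\<Sum>i. ?\<mu> (B i)) = (\<Sum>i. emeasure ?D (B i) + emeasure ?R (B i))"
      using B by (intro suminf_cong eq) auto
    also have "\<dots> = (\<Sum>i. emeasure ?D (B i)) + (\<Sum>i. emeasure ?R (B i))"
      by (intro suminf_add[symmetric]) auto
    also have "\<dots> = emeasure ?D (\<Union> (range B)) + emeasure ?R (\<Union> (range B))"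
      using B by (intro arg_cong2[where f="(+)"] suminf_emeasure) auto
    also have "\<dots> = ?\<mu> (\<Union> (range B))" using eq[OF B(3)] by simp
    finally show "(\<Sum>i. ?\<mu> (B i)) = ?\<mu> (\<Union> (range B))" .
  qed
  moreover have "positive (sets (leb_on X)) ?\<mu>" by (simp add: positive_def)
  ultimately show ?thesis
    unfolding imh_kernel_def using A sets.sigma_algebra_axioms[of "leb_on X"]
    by (intro emeasure_measure_of_sigma) auto
qed

lemma prob_space_imh_kernel:
  assumes x: "x \<in> X"
  shows "prob_space (imh_kernel X \<pi> p x)"
proof
  have m[measurable]: "(\<lambda>y. imh_accept \<pi> p x y) \<in> borel_measurable (leb_on X)"
    unfolding imh_accept_def imh_weight_def by measurable
  have X: "X \<in> sets (leb_on X)" using sets.top[of "leb_on X"] by simp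
  have "emeasure (imh_kernel X \<pi> p x) X =
     (\<integral>\<^sup>+y. ennreal (imh_accept \<pi> p x y * p y) \<partial>leb_on X)
     + (\<integral>\<^sup>+y. ennreal ((1 - imh_accept \<pi> p x y) * p y) \<partial>leb_on X)"
    unfolding emeasure_imh_kernel[OF x X] reject_nn[OF x] using x
    by (intro arg_cong2[where f="(+)"] nn_integral_cong) auto
  also have "\<dots> = (\<integral>\<^sup>+y. ennreal (imh_accept \<pi> p x y * p y) + ennreal ((1 - imh_accept \<pi> p x y) * p y) \<partial>leb_on X)"
    by (intro nn_integral_add[symmetric]) auto
  also have "\<dots> = (\<integral>\<^sup>+y. ennreal (p y) \<partial>leb_on X)"
    using accept_range[OF x] nonneg
    by (intro nn_integral_cong, subst ennreal_plus[symmetric])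
      (auto simp: algebra_simps mult_left_le)
  finally show "emeasure (imh_kernel X \<pi> p x) (space (imh_kernel X \<pi> p x)) = 1"
    using p_mass by simp
qed

lemma measurable_imh_kernel:
  "imh_kernel X \<pi> p \<in> measurable (leb_on X) (subprob_algebra (leb_on X))"
proof (rule measurable_subprob_algebra)
  fix x assume "x \<in> space (leb_on X)"
  then show "subprob_space (imh_kernel X \<pi> p x)"
    using prob_space_imh_kernel by (auto intro: prob_space_imp_subprob_space)
next
  fix A assume A[measurable]: "A \<in> sets (leb_on X)"
  interpret sigma_finite_measure "leb_on X"
    unfolding leb_on_def using X_borel
    by (intro sigma_finite_measure_restrict_space sigma_finite_lborel) auto
  have "(\<lambda>x. (\<integral>\<^sup>+y\<in>A. ennreal (imh_accept \<pi> p x y * p y) \<partial>leb_on X)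
          + (\<integral>\<^sup>+y. ennreal ((1 - imh_accept \<pi> p x y) * p y) \<partial>leb_on X) * indicator A x)
        \<in> borel_measurable (leb_on X)"
    by measurable
  then show "(\<lambda>x. emeasure (imh_kernel X \<pi> p x) A) \<in> borel_measurable (leb_on X)"
    by (rule measurable_cong[THEN iffD1, rotated])
      (simp add: emeasure_imh_kernel reject_nn A)
qed simp

end

text \<open>
  For an arbitrary Polish subset, continuity does not tie the values of the densities on a null
  relatively open piece of the state space (an isolated point, say) to the laws they define. The
  supremum of the weight is then not seen by the chain. The following shows that the positivity condition on relatively open sets is automatic when the
  state space is contained in the closure of its interior, in particular for the whole space.
\<close>

lemma open_charged_if_subset_closure_interior:
  fixes X :: "'a::euclidean_space set"
  assumes "X \<subseteq> closure (interior X)" "openin (top_of_set X) U" "U \<noteq> {}"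
    and "X \<in> sets borel"
  shows "0 < emeasure lborel U"
proof -
  obtain V where V: "open V" "U = X \<inter> V" using assms(2) by (auto simp: openin_open)
  have "V \<inter> interior X \<noteq> {}"
    using assms V open_Int_closure_eq_empty[of V "interior X"] by auto
  moreover have "open (V \<inter> interior X)" using V by auto
  ultimately obtain a b where ab: "cbox a b \<subseteq> V \<inter> interior X" "box a b \<noteq> {}"
    by (metis all_not_in_conv open_contains_cbox empty_iff)
  have "0 < emeasure lborel (cbox a b)"
    using ab(2)
    by (auto simp: emeasure_lborel_cbox_eq box_ne_empty inner_diff_left
        intro!: prod_pos order.strict_implies_order)
  also have "\<dots> \<le> emeasure lborel U"
    using ab(1) interior_subset[of X] assms(4) V
    by (intro emeasure_mono) auto
  finally show ?thesis .
qed

end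

theory Submission
  imports Defs
begin

text \<open>
  Write \<open>T\<close> for the Markov operator of the chain, so that \<open>P\<^sup>n(x, A) = (T\<^sup>n 1\<^sub>A)(x)\<close>. Since
  \<open>min {w(y)/w(x), 1} p(y) \<ge> \<pi>(y)/w\<^sup>\<star>\<close> (Doeblin's condition), each step contracts
  deviations from the mean by the factor \<open>1 - 1/w\<^sup>\<star>\<close>, which gives the upper bound.

  If \<open>w(x) = w\<^sup>\<star>\<close>, this contraction is an equality at \<open>x\<close>, and the event \<open>{x}\<close>
  gives the matching lower bound. Otherwise take \<open>w(x) < v < w\<^sup>\<star>\<close> with \<open>v \<ge> 1\<close> and
  the event \<open>B = {w > v}\<close>, which has positive mass. The functions \<open>g\<^sub>n = T\<^sup>n 1\<^sub>B\<close> are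
  nondecreasing in the weight and constant on \<open>{0 < w \<le> v}\<close>. Hence a step from \<open>x\<close> only gains from
  moves into \<open>B\<close>, where \<open>p \<le> \<pi>/v\<close>, so the gap \<open>\<pi>(B) - g\<^sub>n(x)\<close> shrinks by at most the factor
  \<open>1 - 1/v\<close> per step. Let \<open>v\<close> tend to \<open>w\<^sup>\<star>\<close>.
\<close>

section \<open>The Markov operator on functions with values in [0,1]\<close>

text \<open>Acceptance and rejection share one integral against \<open>p\<close>, so the value at
  \<open>x\<close> is an average over proposals of convex combinations of \<open>f y\<close> and
  \<open>f x\<close>. Comparisons between values of the operator then reduce to pointwise
  comparisons in the proposal.\<close>

definition imh_op ::
  "'a::euclidean_space set \<Rightarrow> ('a \<Rightarrow> real) \<Rightarrow> ('a \<Rightarrow> real) \<Rightarrow> ('a \<Rightarrow> real) \<Rightarrow> 'a \<Rightarrow> real" where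
  "imh_op X \<pi> p f x =
     (\<integral>y. (imh_accept \<pi> p x y * f y + (1 - imh_accept \<pi> p x y) * f x) * p y \<partial>leb_on X)"

text \<open>A class that contains the indicators of events and is preserved by the operator.
  Boundedness makes the integrands below integrable, so the default value 0 of a divergent Bochner
  integral never interferes.\<close>

definition unit_valued_on :: "'a::euclidean_space set \<Rightarrow> ('a \<Rightarrow> real) \<Rightarrow> bool" where
  "unit_valued_on X f \<longleftrightarrow> f \<in> borel_measurable (leb_on X) \<and> (\<forall>x\<in>X. f x \<in> {0..1})"

lemma convex_combination_in_unit:
  fixes a u v :: real
  assumes "a \<in> {0..1}" "u \<in> {0..1}" "v \<in> {0..1}"
  shows "a * u + (1 - a) * v \<in> {0..1}"
  using assms convex_bound_le[of u 1 v a "1 - a"] by auto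

context imh
begin

lemma sigma_finite_leb_on: "sigma_finite_measure (leb_on X)"
  unfolding leb_on_def using X_borel
  by (intro sigma_finite_measure_restrict_space sigma_finite_lborel) auto

lemma AE_leb_on: "(AE x in leb_on X. P x) \<longleftrightarrow> (AE x in lborel. x \<in> X \<longrightarrow> P x)"
  unfolding leb_on_def using X_borel by (subst AE_restrict_space_iff) auto

lemma accept_meas1 [measurable]: "imh_accept \<pi> p x \<in> borel_measurable (leb_on X)"
  unfolding imh_accept_def imh_weight_def by measurable

lemma integral_p: "integrable (leb_on X) p" "integral\<^sup>L (leb_on X) p = 1"
proof -
  show "integrable (leb_on X) p"
    using p_mass nonneg by (intro integrableI_nonneg) (auto intro: AE_I2)
  show "integral\<^sup>L (leb_on X) p = 1"
    using nonneg p_mass by (subst integral_eq_nn_integral) (auto intro: AE_I2)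
qed

lemma integral_\<pi>: "integrable (leb_on X) \<pi>" "integral\<^sup>L (leb_on X) \<pi> = 1"
proof -
  \<comment> \<open>The locale does not relate the two densities, so \<open>\<pi>\<close> may also
    play the proposal; facts about \<open>p\<close> then become facts about
    \<open>\<pi>\<close>.\<close>
  interpret self: imh X \<pi> \<pi>
    using X_borel dens_\<pi> by unfold_locales
  show "integrable (leb_on X) \<pi>" "integral\<^sup>L (leb_on X) \<pi> = 1"
    using self.integral_p by auto
qed

lemma integrable_mult_p:
  assumes "g \<in> borel_measurable (leb_on X)" "\<And>y. y \<in> X \<Longrightarrow> \<bar>g y\<bar> \<le> C"
  shows "integrable (leb_on X) (\<lambda>y. g y * p y)"
proof (rule Bochner_Integration.integrable_bound)
  show "integrable (leb_on X) (\<lambda>y. C * p y)"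
    using integral_p by simp
  have "\<bar>g y * p y\<bar> \<le> \<bar>C * p y\<bar>" if "y \<in> X" for y
    using assms(2)[OF that] nonneg(2)[OF that] by (auto simp: abs_mult intro!: mult_right_mono)
  then show "AE y in leb_on X. norm (g y * p y) \<le> norm (C * p y)"
    by (intro AE_I2) auto
qed (use assms(1) in measurable)

lemma integrable_mult_\<pi>:
  assumes "g \<in> borel_measurable (leb_on X)" "\<And>y. y \<in> X \<Longrightarrow> \<bar>g y\<bar> \<le> C"
  shows "integrable (leb_on X) (\<lambda>y. g y * \<pi> y)"
proof -
  interpret self: imh X \<pi> \<pi>
    using X_borel dens_\<pi> by unfold_locales
  show ?thesis using self.integrable_mult_p assms by blast
qed

lemma unit_valued_integrable_\<pi>:
  "unit_valued_on X f \<Longrightarrow> integrable (leb_on X) (\<lambda>y. f y * \<pi> y)"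
  by (rule integrable_mult_\<pi>[where C=1]) (auto simp: unit_valued_on_def)

lemma unit_valued_integrable:
  assumes "unit_valued_on X f" "x \<in> X"
  shows "integrable (leb_on X) (\<lambda>y. (imh_accept \<pi> p x y * f y + (1 - imh_accept \<pi> p x y) * f x) * p y)"
    and "integrable (leb_on X) (\<lambda>y. (imh_accept \<pi> p x y * f y) * p y)"
    and "integrable (leb_on X) (\<lambda>y. ((1 - imh_accept \<pi> p x y) * f x) * p y)"
proof -
  have [measurable]: "f \<in> borel_measurable (leb_on X)" and f: "\<And>y. y \<in> X \<Longrightarrow> f y \<in> {0..1}"
    using assms by (auto simp: unit_valued_on_def)
  note a = accept_range[OF assms(2)]
  show "integrable (leb_on X) (\<lambda>y. (imh_accept \<pi> p x y * f y + (1 - imh_accept \<pi> p x y) * f x) * p y)"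
    by (rule integrable_mult_p[where C=1])
      (measurable, use convex_combination_in_unit[OF a f f[OF assms(2)]] in auto)
  show "integrable (leb_on X) (\<lambda>y. (imh_accept \<pi> p x y * f y) * p y)"
    using a f
    by (intro integrable_mult_p[where C=1]) (measurable, auto simp: abs_mult intro!: mult_le_one)
  show "integrable (leb_on X) (\<lambda>y. ((1 - imh_accept \<pi> p x y) * f x) * p y)"
    using a f assms(2)
    by (intro integrable_mult_p[where C=1]) (measurable, auto simp: abs_mult intro!: mult_le_one)
qed

lemma unit_valued_imh_op:
  assumes "unit_valued_on X f"
  shows "unit_valued_on X (imh_op X \<pi> p f)"
  unfolding unit_valued_on_def
proof (intro conjI ballI)
  have [measurable]: "f \<in> borel_measurable (leb_on X)" and f: "\<And>y. y \<in> X \<Longrightarrow> f y \<in> {0..1}"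
    using assms by (auto simp: unit_valued_on_def)
  interpret sigma_finite_measure "leb_on X" by (rule sigma_finite_leb_on)
  show "imh_op X \<pi> p f \<in> borel_measurable (leb_on X)"
    unfolding imh_op_def by measurable
  fix x assume x: "x \<in> X"
  note cc = convex_combination_in_unit[OF accept_range[OF x] f f[OF x]]
  have "0 \<le> imh_op X \<pi> p f x"
    unfolding imh_op_def using cc nonneg by (intro integral_nonneg_AE AE_I2) auto
  moreover have "imh_op X \<pi> p f x \<le> integral\<^sup>L (leb_on X) p"
    unfolding imh_op_def using cc nonneg
    by (intro integral_mono unit_valued_integrable[OF assms x] integral_p(1))
       (auto intro!: mult_left_le_one_le)
  ultimately show "imh_op X \<pi> p f x \<in> {0..1}" using integral_p(2) by simp
qed

lemma unit_valued_imh_op_funpow: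
  "unit_valued_on X f \<Longrightarrow> unit_valued_on X ((imh_op X \<pi> p ^^ n) f)"
  by (induction n) (auto intro: unit_valued_imh_op)

section \<open>From the operator to the n-step kernel\<close>

text \<open>The kernel is defined by \<open>measure_of\<close> from its values on events, so its
  integrals are built up from indicators by the standard induction on nonnegative measurable
  functions.\<close>

lemma nn_integral_imh_kernel:
  assumes x: "x \<in> X" and f: "f \<in> borel_measurable (leb_on X)"
  shows "(\<integral>\<^sup>+y. f y \<partial>imh_kernel X \<pi> p x) =
     (\<integral>\<^sup>+y. ennreal (imh_accept \<pi> p x y * p y) * f y \<partial>leb_on X) + ennreal (imh_reject X \<pi> p x) * f x"
    (is "?K f = ?I f + ?R * f x")
  using f
proof (induction rule: borel_measurable_induct)
  case (cong f g)
  have "?K f = ?K g" "?I f = ?I g"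
    using cong(3) by (auto intro!: nn_integral_cong)
  then show ?case using cong(3,4) x by simp
next
  case (set A)
  then show ?case by (simp add: emeasure_imh_kernel[OF x])
next
  case (mult u c)
  have [measurable]: "u \<in> borel_measurable (leb_on X)" by fact
  have "?I (\<lambda>y. c * u y) = c * ?I u"
    by (subst nn_integral_cmult[symmetric]) (auto simp: mult_ac)
  then show ?case
    using mult by (simp add: nn_integral_cmult measurable_cong_sets[OF sets_imh_kernel refl] ring_distribs mult_ac)
next
  case (add u v)
  have [measurable]: "u \<in> borel_measurable (leb_on X)" "v \<in> borel_measurable (leb_on X)" by fact+
  have "?I (\<lambda>y. v y + u y) = ?I v + ?I u"
    by (subst nn_integral_add[symmetric]) (auto simp: ring_distribs)
  then show ?case
    using add by (simp add: nn_integral_add measurable_cong_sets[OF sets_imh_kernel refl] ring_distribs add_ac)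
next
  case (seq U)
  have m [measurable]: "U i \<in> borel_measurable (leb_on X)" for i by fact
  have "?K (SUP i. U i) = (SUP i. ?K (U i))"
    using seq(1,3) unfolding SUP_apply
    by (subst nn_integral_monotone_convergence_SUP) (auto simp: measurable_cong_sets[OF sets_imh_kernel refl])
  also have "\<dots> = (SUP i. ?I (U i) + ?R * U i x)"
    using seq by simp
  also have "\<dots> = (SUP i. ?I (U i)) + (SUP i. ?R * U i x)"
    using seq(3)
    by (intro ennreal_SUP_add) (auto simp: incseq_def le_fun_def intro!: nn_integral_mono mult_left_mono)
  also have "(SUP i. ?I (U i)) = (\<integral>\<^sup>+y. (SUP i. ennreal (imh_accept \<pi> p x y * p y) * U i y) \<partial>leb_on X)"
    using seq(3)
    by (intro nn_integral_monotone_convergence_SUP[symmetric])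
       (auto simp: incseq_def le_fun_def intro!: mult_left_mono)
  also have "\<dots> = ?I (SUP i. U i)"
    by (simp add: SUP_mult_left_ennreal image_comp)
  also have "(SUP i. ?R * U i x) = ?R * (SUP i. U i) x"
    by (simp add: SUP_mult_left_ennreal image_comp)
  finally show ?case .
qed

text \<open>Passage from extended nonnegative integrals to the real-valued operator: the accepted
  and the rejected part are each nonnegative and integrable.\<close>

lemma nn_integral_imh_kernel_unit_valued:
  assumes x: "x \<in> X" and f: "unit_valued_on X f"
  shows "(\<integral>\<^sup>+y. ennreal (f y) \<partial>imh_kernel X \<pi> p x) = ennreal (imh_op X \<pi> p f x)"
proof -
  have [measurable]: "f \<in> borel_measurable (leb_on X)" and f01: "\<And>y. y \<in> X \<Longrightarrow> f y \<in> {0..1}"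
    using f by (auto simp: unit_valued_on_def)
  note a = accept_range[OF x]
  note int = unit_valued_integrable[OF f x]
  have "(\<integral>\<^sup>+y. ennreal (f y) \<partial>imh_kernel X \<pi> p x) =
     (\<integral>\<^sup>+y. ennreal (imh_accept \<pi> p x y * f y * p y) \<partial>leb_on X) + ennreal (imh_reject X \<pi> p x) * ennreal (f x)"
    using a f01 nonneg
    by (subst nn_integral_imh_kernel[OF x])
       (auto simp: ennreal_mult'[symmetric] mult_ac intro!: nn_integral_cong arg_cong2[where f="(+)"])
  also have "(\<integral>\<^sup>+y. ennreal (imh_accept \<pi> p x y * f y * p y) \<partial>leb_on X) =
      ennreal (\<integral>y. imh_accept \<pi> p x y * f y * p y \<partial>leb_on X)"
    using int(2) a f01 nonneg by (intro nn_integral_eq_integral AE_I2) auto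
  also have "ennreal (imh_reject X \<pi> p x) * ennreal (f x) =
      ennreal (\<integral>y. ((1 - imh_accept \<pi> p x y) * f x) * p y \<partial>leb_on X)"
  proof -
    have "(\<integral>y. ((1 - imh_accept \<pi> p x y) * f x) * p y \<partial>leb_on X) = imh_reject X \<pi> p x * f x"
      unfolding imh_reject_def by (subst integral_mult_left_zero[symmetric]) (simp add: mult_ac)
    then show ?thesis
      using f01[OF x] by (simp add: ennreal_mult'')
  qed
  also have "ennreal (\<integral>y. imh_accept \<pi> p x y * f y * p y \<partial>leb_on X) + \<dots> =
      ennreal ((\<integral>y. imh_accept \<pi> p x y * f y * p y \<partial>leb_on X) +
        (\<integral>y. ((1 - imh_accept \<pi> p x y) * f x) * p y \<partial>leb_on X))"
    using a f01 x nonneg by (intro ennreal_plus[symmetric] integral_nonneg_AE AE_I2) auto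
  also have "\<dots> = ennreal (imh_op X \<pi> p f x)"
    unfolding imh_op_def using int(2,3) by (simp add: ring_distribs)
  finally show ?thesis .
qed

lemma sets_imh_steps:
  "x \<in> X \<Longrightarrow> sets (imh_steps X \<pi> p n x) = sets (leb_on X)"
proof (induction n)
  case (Suc n)
  then have "space (imh_steps X \<pi> p n x) = X"
    using sets_eq_imp_space_eq[OF Suc.IH] by simp
  then show ?case using Suc by (auto intro!: sets_bind)
qed simp

text \<open>The recursion of \<open>imh_steps\<close> appends the new step at the end. Integrating
  that step out first replaces \<open>f\<close> by its image under the operator, hence the induction
  must generalise over \<open>f\<close>.\<close>

lemma nn_integral_imh_steps:
  assumes x: "x \<in> X" and f: "unit_valued_on X f"
  shows "(\<integral>\<^sup>+y. ennreal (f y) \<partial>imh_steps X \<pi> p n x) = ennreal ((imh_op X \<pi> p ^^ n) f x)"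
  using f
proof (induction n arbitrary: f)
  case 0
  then have [measurable]: "f \<in> borel_measurable (leb_on X)" by (simp add: unit_valued_on_def)
  show ?case using x by (simp add: nn_integral_return)
next
  case (Suc n)
  have [measurable]: "f \<in> borel_measurable (leb_on X)" using Suc.prems by (simp add: unit_valued_on_def)
  have sp: "space (imh_steps X \<pi> p n x) = X"
    using sets_eq_imp_space_eq[OF sets_imh_steps[OF x]] by simp
  have "(\<integral>\<^sup>+y. ennreal (f y) \<partial>imh_steps X \<pi> p (Suc n) x) =
      (\<integral>\<^sup>+z. (\<integral>\<^sup>+y. ennreal (f y) \<partial>imh_kernel X \<pi> p z) \<partial>imh_steps X \<pi> p n x)"
    unfolding imh_steps.simps
    by (intro nn_integral_bind[where B="leb_on X"])
       (simp_all add: measurable_cong_sets[OF sets_imh_steps[OF x] refl] measurable_imh_kernel)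
  also have "\<dots> = (\<integral>\<^sup>+z. ennreal (imh_op X \<pi> p f z) \<partial>imh_steps X \<pi> p n x)"
    using Suc.prems sp by (intro nn_integral_cong nn_integral_imh_kernel_unit_valued) auto
  also have "\<dots> = ennreal ((imh_op X \<pi> p ^^ n) (imh_op X \<pi> p f) x)"
    by (intro Suc.IH unit_valued_imh_op Suc.prems)
  finally show ?case by (simp add: funpow_swap1)
qed

lemma unit_valued_indicator: "A \<in> sets (leb_on X) \<Longrightarrow> unit_valued_on X (indicator A)"
  by (auto simp: unit_valued_on_def indicator_def)

lemma measure_imh_steps:
  assumes x: "x \<in> X" and A: "A \<in> sets (leb_on X)"
  shows "measure (imh_steps X \<pi> p n x) A = (imh_op X \<pi> p ^^ n) (indicator A) x"
proof -
  have "emeasure (imh_steps X \<pi> p n x) A = (\<integral>\<^sup>+y. ennreal (indicator A y) \<partial>imh_steps X \<pi> p n x)"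
    using A sets_imh_steps[OF x] by (simp add: ennreal_indicator)
  also have "\<dots> = ennreal ((imh_op X \<pi> p ^^ n) (indicator A) x)"
    by (rule nn_integral_imh_steps[OF x unit_valued_indicator[OF A]])
  finally show ?thesis
    using unit_valued_imh_op_funpow[OF unit_valued_indicator[OF A], of n] x
    by (simp add: measure_def unit_valued_on_def)
qed

lemma measure_law_on:
  assumes A: "A \<in> sets (leb_on X)"
  shows "measure (law_on X \<pi>) A = (\<integral>y. indicator A y * \<pi> y \<partial>leb_on X)"
proof -
  have "emeasure (law_on X \<pi>) A = (\<integral>\<^sup>+y. ennreal (indicator A y * \<pi> y) \<partial>leb_on X)"
    unfolding law_on_def using A
    by (subst emeasure_density) (auto intro!: nn_integral_cong simp: indicator_def)
  also have "\<dots> = ennreal (\<integral>y. indicator A y * \<pi> y \<partial>leb_on X)"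
    using unit_valued_integrable_\<pi>[OF unit_valued_indicator[OF A]] nonneg
    by (intro nn_integral_eq_integral AE_I2) (auto simp: indicator_def)
  moreover have "0 \<le> (\<integral>y. indicator A y * \<pi> y \<partial>leb_on X)"
    using nonneg by (intro integral_nonneg_AE AE_I2) (auto simp: indicator_def)
  ultimately show ?thesis by (simp add: measure_def)
qed

section \<open>Invariance of the target\<close>

text \<open>One step changes the mean of \<open>f\<close> by the integral of the increments
  \<open>f y - f x\<close> against the flow of accepted moves. Under the target this flow is the
  same in both directions, so the increments cancel.\<close>

lemma integral_imh_op:
  assumes f: "unit_valued_on X f" and supp: "supp_on X \<pi> \<subseteq> supp_on X p"
  shows "(\<integral>x. imh_op X \<pi> p f x * \<pi> x \<partial>leb_on X) = (\<integral>x. f x * \<pi> x \<partial>leb_on X)"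
proof -
  let ?M = "leb_on X"
  have [measurable]: "f \<in> borel_measurable ?M" and f01: "\<And>y. y \<in> X \<Longrightarrow> f y \<in> {0..1}"
    using f by (auto simp: unit_valued_on_def)
  interpret sigma_finite_measure ?M by (rule sigma_finite_leb_on)
  interpret P: pair_sigma_finite ?M ?M ..
  \<comment> \<open>By detailed balance the probability flow is symmetric, so \<open>D\<close> is antisymmetric.\<close>
  define D where "D = (\<lambda>(x, y). min (\<pi> y * p x) (\<pi> x * p y) * (f y - f x))"
  have [measurable]: "D \<in> borel_measurable (?M \<Otimes>\<^sub>M ?M)"
    unfolding D_def by measurable
  \<comment> \<open>This product density dominates \<open>D\<close>, because the increments of
    \<open>f\<close> are at most 1 in absolute value; Fubini then applies to
    \<open>D\<close>.\<close>
  have dom: "integrable (?M \<Otimes>\<^sub>M ?M) (\<lambda>(x, y). \<pi> x * p y)"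
  proof (rule P.Fubini_integrable)
    have "(\<lambda>x. \<integral>y. norm (\<pi> x * p y) \<partial>?M) = (\<lambda>x. \<bar>\<pi> x\<bar> * (\<integral>y. \<bar>p y\<bar> \<partial>?M))"
      by (simp add: abs_mult)
    then show "integrable ?M (\<lambda>x. \<integral>y. norm (case (x, y) of (x, y) \<Rightarrow> \<pi> x * p y) \<partial>?M)"
      using integral_\<pi>(1) by simp
    show "AE x in ?M. integrable ?M (\<lambda>y. case (x, y) of (x, y) \<Rightarrow> \<pi> x * p y)"
      using integral_p(1) by simp
  qed simp
  have D_int: "integrable (?M \<Otimes>\<^sub>M ?M) D"
  proof (rule Bochner_Integration.integrable_bound[OF dom])
    have "\<bar>D (x, y)\<bar> \<le> \<pi> x * p y" if "x \<in> X" "y \<in> X" for x y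
    proof -
      have "\<bar>f y - f x\<bar> \<le> 1" using f01[OF that(1)] f01[OF that(2)] by auto
      moreover have "0 \<le> min (\<pi> y * p x) (\<pi> x * p y)" using nonneg that by simp
      ultimately have "\<bar>D (x, y)\<bar> \<le> min (\<pi> y * p x) (\<pi> x * p y)"
        unfolding D_def split abs_mult using mult_left_le by (metis abs_of_nonneg)
      then show ?thesis by simp
    qed
    then show "AE z in ?M \<Otimes>\<^sub>M ?M. norm (D z) \<le> norm (case z of (x, y) \<Rightarrow> \<pi> x * p y)"
      using nonneg by (intro AE_I2) (auto simp: space_pair_measure)
  qed simp
  have "integral\<^sup>L (?M \<Otimes>\<^sub>M ?M) D = (\<integral>(x, y). D (y, x) \<partial>(?M \<Otimes>\<^sub>M ?M))"
    by (rule P.integral_product_swap[symmetric]) simp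
  also have "\<dots> = (\<integral>z. - D z \<partial>(?M \<Otimes>\<^sub>M ?M))"
    by (intro Bochner_Integration.integral_cong) (auto simp: D_def algebra_simps min_def)
  finally have D0: "integral\<^sup>L (?M \<Otimes>\<^sub>M ?M) D = 0"
    by simp
  \<comment> \<open>Where all densities involved in the ratio are positive this is
    cross-multiplication. If \<open>\<pi> x = 0\<close> both sides vanish; if
    \<open>p y = 0\<close>, the inclusion of supports forces \<open>\<pi> y = 0\<close> and again
    both sides vanish.\<close>
  have bal: "imh_accept \<pi> p x y * p y * \<pi> x = min (\<pi> y * p x) (\<pi> x * p y)" if xy: "x \<in> X" "y \<in> X" for x y
  proof (cases "\<pi> x > 0 \<and> p y > 0")
    case True
    then have "p x > 0" using supp xy by (auto simp: supp_on_def)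
    then show ?thesis
      using True by (auto simp: imh_accept_def imh_weight_def min_def field_simps)
  next
    case False
    then consider "\<pi> x = 0" | "p y = 0" using nonneg(1)[OF xy(1)] nonneg(2)[OF xy(2)] by fastforce
    then show ?thesis
    proof cases
      case 2
      then have "\<pi> y = 0" using supp xy nonneg(1)[OF xy(2)] by (force simp: supp_on_def)
      then show ?thesis using 2 by simp
    qed (use nonneg xy in auto)
  qed
  have "imh_op X \<pi> p f x * \<pi> x = f x * \<pi> x + (\<integral>y. D (x, y) \<partial>?M)" if x: "x \<in> X" for x
  proof -
    have "imh_op X \<pi> p f x = (\<integral>y. f x * p y + imh_accept \<pi> p x y * (f y - f x) * p y \<partial>?M)"
      unfolding imh_op_def by (intro Bochner_Integration.integral_cong) (auto simp: algebra_simps)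
    also have "\<dots> = f x + (\<integral>y. imh_accept \<pi> p x y * (f y - f x) * p y \<partial>?M)"
    proof (subst Bochner_Integration.integral_add)
      show "integrable ?M (\<lambda>y. imh_accept \<pi> p x y * (f y - f x) * p y)"
      proof (rule integrable_mult_p)
        fix y assume y: "y \<in> X"
        have "\<bar>f y - f x\<bar> \<le> 1" using f01[OF x] f01[OF y] by auto
        then show "\<bar>imh_accept \<pi> p x y * (f y - f x)\<bar> \<le> 1"
          using accept_range[OF x y] by (simp add: abs_mult mult_le_one)
      qed measurable
    qed (use integral_p in auto)
    finally have "imh_op X \<pi> p f x * \<pi> x =
        f x * \<pi> x + (\<integral>y. imh_accept \<pi> p x y * (f y - f x) * p y * \<pi> x \<partial>?M)"
      by (simp add: distrib_right)
    also have "(\<integral>y. imh_accept \<pi> p x y * (f y - f x) * p y * \<pi> x \<partial>?M) = (\<integral>y. D (x, y) \<partial>?M)"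
      using bal[OF x] by (intro Bochner_Integration.integral_cong) (auto simp: D_def mult_ac)
    finally show ?thesis .
  qed
  then have "(\<integral>x. imh_op X \<pi> p f x * \<pi> x \<partial>?M) = (\<integral>x. f x * \<pi> x + (\<integral>y. D (x, y) \<partial>?M) \<partial>?M)"
    by (intro Bochner_Integration.integral_cong) auto
  also have "\<dots> = (\<integral>x. f x * \<pi> x \<partial>?M) + (\<integral>x. (\<integral>y. D (x, y) \<partial>?M) \<partial>?M)"
    using unit_valued_integrable_\<pi>[OF f] P.integrable_fst'[OF D_int]
    by (intro Bochner_Integration.integral_add) auto
  also have "(\<integral>x. (\<integral>y. D (x, y) \<partial>?M) \<partial>?M) = 0"
    using P.integral_fst'[OF D_int] D0 by simp
  finally show ?thesis by simp
qed

end

section \<open>Minorization and the upper bound\<close>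

text \<open>Boundedness is what makes the real-valued supremum in \<open>imh_wstar\<close> an actual
  upper bound of the weights.\<close>

locale imh_dominated = imh +
  assumes supp: "supp_on X \<pi> \<subseteq> supp_on X p"
    and bdd: "bdd_above (imh_weight \<pi> p ` supp_on X p)"
begin

abbreviation "w \<equiv> imh_weight \<pi> p"
abbreviation "wstar \<equiv> imh_wstar X \<pi> p"
abbreviation "T \<equiv> imh_op X \<pi> p"
abbreviation "mean f \<equiv> (\<integral>y. f y * \<pi> y \<partial>leb_on X)"

lemma weight_nonneg: "y \<in> X \<Longrightarrow> 0 \<le> w y"
  using nonneg by (simp add: imh_weight_def)

lemma weight_pos_iff: "y \<in> X \<Longrightarrow> 0 < w y \<longleftrightarrow> y \<in> supp_on X \<pi>"
  using supp nonneg by (force simp: imh_weight_def supp_on_def zero_less_divide_iff)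

text \<open>Valid off the support of \<open>p\<close> too: there the target vanishes by the
  inclusion of supports, and the weight is 0 because division by 0 gives 0.\<close>

lemma target_eq_weight_mult: "y \<in> X \<Longrightarrow> \<pi> y = w y * p y"
  using supp nonneg by (force simp: imh_weight_def supp_on_def)

lemma weight_le_wstar: "y \<in> supp_on X p \<Longrightarrow> w y \<le> wstar"
  unfolding imh_wstar_def using bdd by (rule cSUP_upper2) auto

lemma target_le: "y \<in> X \<Longrightarrow> \<pi> y \<le> wstar * p y"
  using weight_le_wstar[of y] target_eq_weight_mult[of y] nonneg[of y]
  by (cases "p y > 0") (auto simp: supp_on_def intro: mult_right_mono)

text \<open>Integrate \<open>target_le\<close>: both densities have total mass 1. Hence
  \<open>1 - 1 / wstar\<close> is a nonnegative contraction factor.\<close>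

lemma wstar_ge_1: "1 \<le> wstar"
proof -
  have "integral\<^sup>L (leb_on X) \<pi> \<le> (\<integral>y. wstar * p y \<partial>leb_on X)"
    using integral_p integral_\<pi> target_le by (intro integral_mono) auto
  then show ?thesis using integral_p integral_\<pi> by simp
qed

text \<open>Doeblin's minorization for densities. If the minimum is 1, it is
  \<open>target_le\<close>; otherwise the left factor is \<open>w y / w x\<close>, and
  \<open>w y * p y\<close> is \<open>\<pi> y\<close> while \<open>w x\<close> is at most
  \<open>wstar\<close>.\<close>

lemma accept_mult_ge:
  assumes "x \<in> supp_on X \<pi>" "y \<in> X"
  shows "\<pi> y / wstar \<le> imh_accept \<pi> p x y * p y"
proof -
  have x: "x \<in> X" "0 < w x" "w x \<le> wstar"
    using assms(1) weight_pos_iff weight_le_wstar supp by (auto simp: supp_on_def)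
  have "\<pi> y / wstar \<le> p y"
    using target_le[OF assms(2)] wstar_ge_1 by (simp add: field_simps)
  moreover have "\<pi> y / wstar \<le> w y / w x * p y"
    using x nonneg[OF assms(2)] by (auto simp: target_eq_weight_mult[OF assms(2), symmetric] intro!: divide_left_mono)
  ultimately show ?thesis by (auto simp: imh_accept_def min_def)
qed

lemma mean_diff:
  assumes "unit_valued_on X f"
  shows "mean f - c = (\<integral>y. (f y - c) * \<pi> y \<partial>leb_on X)"
    and "integrable (leb_on X) (\<lambda>y. (f y - c) * \<pi> y)"
  using unit_valued_integrable_\<pi>[OF assms] integral_\<pi>
  by (simp_all add: left_diff_distrib)

text \<open>Constants pass through the operator because \<open>p\<close> has mass 1. The free
  constant \<open>c\<close> is later the mean of \<open>f\<close>, for the contraction, or a value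
  of \<open>f\<close>, which removes the rejection term.\<close>

lemma imh_op_diff:
  assumes f: "unit_valued_on X f" and x: "x \<in> X"
  shows "T f x - c =
      (\<integral>y. (imh_accept \<pi> p x y * (f y - c) + (1 - imh_accept \<pi> p x y) * (f x - c)) * p y \<partial>leb_on X)"
    and "integrable (leb_on X)
      (\<lambda>y. (imh_accept \<pi> p x y * (f y - c) + (1 - imh_accept \<pi> p x y) * (f x - c)) * p y)"
proof -
  have *: "(imh_accept \<pi> p x y * (f y - c) + (1 - imh_accept \<pi> p x y) * (f x - c)) * p y =
      (imh_accept \<pi> p x y * f y + (1 - imh_accept \<pi> p x y) * f x) * p y - c * p y" for y
    by (simp add: algebra_simps)
  show "T f x - c =
      (\<integral>y. (imh_accept \<pi> p x y * (f y - c) + (1 - imh_accept \<pi> p x y) * (f x - c)) * p y \<partial>leb_on X)"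
    using unit_valued_integrable(1)[OF f x] integral_p
    unfolding * imh_op_def by (subst Bochner_Integration.integral_diff) auto
  show "integrable (leb_on X)
      (\<lambda>y. (imh_accept \<pi> p x y * (f y - c) + (1 - imh_accept \<pi> p x y) * (f x - c)) * p y)"
    using unit_valued_integrable(1)[OF f x] integral_p unfolding * by auto
qed

text \<open>The centred function integrates to 0 against \<open>\<pi>\<close>, so the fraction
  \<open>1 / wstar\<close> of the target may be removed from the transition law without changing the
  integral. By the minorization a nonnegative measure of mass \<open>1 - 1 / wstar\<close>
  remains.\<close>

lemma imh_op_contraction:
  assumes f: "unit_valued_on X f" and x: "x \<in> supp_on X \<pi>"
    and C: "\<And>y. y \<in> supp_on X \<pi> \<Longrightarrow> \<bar>f y - mean f\<bar> \<le> C"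
  shows "\<bar>T f x - mean f\<bar> \<le> (1 - 1 / wstar) * C"
proof -
  let ?a = "imh_accept \<pi> p x" and ?m = "mean f"
  have xX: "x \<in> X" using x by (simp add: supp_on_def)
  define g where "g y = (?a y * (f y - ?m) + (1 - ?a y) * (f x - ?m)) * p y - (f y - ?m) * \<pi> y / wstar" for y
  have gi: "integrable (leb_on X) g"
    unfolding g_def using imh_op_diff(2)[OF f xX] mean_diff(2)[OF f]
    by (intro Bochner_Integration.integrable_diff integrable_divide_zero) auto
  have "T f x - ?m = integral\<^sup>L (leb_on X) g"
    unfolding g_def using imh_op_diff[OF f xX, of ?m] mean_diff[OF f, of ?m]
    by (subst Bochner_Integration.integral_diff) auto
  also have "norm \<dots> \<le> (\<integral>y. C * p y - C * \<pi> y / wstar \<partial>leb_on X)"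
  proof (intro Bochner_Integration.integral_norm_bound_integral gi)
    fix y assume "y \<in> space (leb_on X)"
    then have y: "y \<in> X" by simp
    have "\<bar>(?a y * p y - \<pi> y / wstar) * (f y - ?m)\<bar> \<le> (?a y * p y - \<pi> y / wstar) * C"
    proof (cases "y \<in> supp_on X \<pi>")
      case True
      then show ?thesis
        using accept_mult_ge[OF x y] C[OF True] by (simp add: abs_mult mult_left_mono)
    next
      \<comment> \<open>The bound \<open>C\<close> says nothing about such \<open>y\<close>, but
        their weight is 0 and they are never accepted.\<close>
      case False
      then have "\<pi> y = 0" using y nonneg[OF y] by (auto simp: supp_on_def)
      then show ?thesis by (simp add: imh_accept_def imh_weight_def)
    qed
    moreover have "\<bar>(1 - ?a y) * p y * (f x - ?m)\<bar> \<le> (1 - ?a y) * p y * C"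
      using accept_range[OF xX y] nonneg[OF y] C[OF x]
      by (simp add: abs_mult mult_left_mono)
    ultimately have "\<bar>(?a y * p y - \<pi> y / wstar) * (f y - ?m) + (1 - ?a y) * p y * (f x - ?m)\<bar>
        \<le> (?a y * p y - \<pi> y / wstar) * C + (1 - ?a y) * p y * C"
      by linarith
    then show "norm (g y) \<le> C * p y - C * \<pi> y / wstar"
      by (simp add: g_def algebra_simps add_divide_distrib diff_divide_distrib)
  qed (use integral_p integral_\<pi> in auto)
  also have "\<dots> = (1 - 1 / wstar) * C"
    using integral_p integral_\<pi> by (simp add: algebra_simps)
  finally show ?thesis by simp
qed

lemma mean_funpow: "unit_valued_on X f \<Longrightarrow> mean ((T ^^ n) f) = mean f"
  by (induction n) (auto simp: integral_imh_op[OF unit_valued_imh_op_funpow supp])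

lemma mean_in_unit:
  assumes "unit_valued_on X f"
  shows "mean f \<in> {0..1}"
proof -
  have f: "\<And>y. y \<in> X \<Longrightarrow> f y \<in> {0..1}" using assms by (auto simp: unit_valued_on_def)
  have "0 \<le> mean f" using f nonneg by (intro integral_nonneg_AE AE_I2) auto
  moreover have "mean f \<le> integral\<^sup>L (leb_on X) \<pi>"
    using f nonneg unit_valued_integrable_\<pi>[OF assms] integral_\<pi>
    by (intro integral_mono) (auto intro!: mult_left_le_one_le)
  ultimately show ?thesis using integral_\<pi> by simp
qed

text \<open>By invariance all iterates have the same mean, so the one-step contraction composes. The
  initial constant is 1, as \<open>f\<close> and its mean lie in [0,1].\<close>

lemma imh_op_funpow_contraction:
  assumes f: "unit_valued_on X f" and x: "x \<in> supp_on X \<pi>"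
  shows "\<bar>(T ^^ n) f x - mean f\<bar> \<le> (1 - 1 / wstar) ^ n"
  using x
proof (induction n arbitrary: x)
  case 0
  then have "f x \<in> {0..1}" using f by (auto simp: unit_valued_on_def supp_on_def)
  then show ?case using mean_in_unit[OF f] by auto
next
  case (Suc n)
  then show ?case
    using imh_op_contraction[OF unit_valued_imh_op_funpow[OF f] Suc.prems, of n "(1 - 1 / wstar) ^ n"]
    by (simp add: mean_funpow[OF f])
qed

section \<open>Exact decay at a state of maximal weight\<close>

text \<open>From such a state the acceptance ratio never exceeds 1 on the support of
  \<open>p\<close>, so accepted moves have density exactly \<open>\<pi> y / wstar\<close>: the chain
  draws from the target with probability \<open>1 / wstar\<close> and stays put otherwise.\<close>

lemma imh_op_at_max_weight:
  assumes f: "unit_valued_on X f" and x: "x \<in> supp_on X \<pi>" "w x = wstar"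
  shows "T f x - mean f = (1 - 1 / wstar) * (f x - mean f)"
proof -
  have xX: "x \<in> X" using x by (simp add: supp_on_def)
  have a: "imh_accept \<pi> p x y * p y = \<pi> y / wstar" if y: "y \<in> X" for y
  proof (cases "p y > 0")
    case True
    then have "w y / wstar \<le> 1" using weight_le_wstar[of y] y wstar_ge_1 by (simp add: supp_on_def)
    then show ?thesis using x(2) target_eq_weight_mult[OF y] by (simp add: imh_accept_def)
  qed (use nonneg[OF y] target_eq_weight_mult[OF y] in auto)
  have "T f x - f x = (\<integral>y. (f y - f x) * \<pi> y / wstar \<partial>leb_on X)"
    unfolding imh_op_diff(1)[OF f xX]
  proof (intro Bochner_Integration.integral_cong refl)
    fix y assume "y \<in> space (leb_on X)"
    then have "(imh_accept \<pi> p x y * p y) * (f y - f x) = \<pi> y / wstar * (f y - f x)"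
      by (simp add: a)
    then show "(imh_accept \<pi> p x y * (f y - f x) + (1 - imh_accept \<pi> p x y) * (f x - f x)) * p y =
        (f y - f x) * \<pi> y / wstar"
      by (simp add: mult_ac)
  qed
  also have "\<dots> = (mean f - f x) / wstar"
    using mean_diff(1)[OF f] by simp
  finally show ?thesis using wstar_ge_1 by (simp add: field_simps)
qed

lemma imh_op_funpow_at_max_weight:
  assumes f: "unit_valued_on X f" and x: "x \<in> supp_on X \<pi>" "w x = wstar"
  shows "(T ^^ n) f x - mean f = (1 - 1 / wstar) ^ n * (f x - mean f)"
proof (induction n)
  case (Suc n)
  then show ?case
    using imh_op_at_max_weight[OF unit_valued_imh_op_funpow[OF f] x, of n]
    by (simp add: mean_funpow[OF f])
qed simp

section \<open>Lower bound for states below the maximal weight\<close>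

definition weight_monotone :: "('a \<Rightarrow> real) \<Rightarrow> bool" where
  "weight_monotone f \<longleftrightarrow> (\<forall>x\<in>supp_on X \<pi>. \<forall>y\<in>supp_on X \<pi>. w x \<le> w y \<longrightarrow> f x \<le> f y)"

text \<open>With \<open>weight_monotone\<close>, the second property that the indicator of
  \<open>{w > v}\<close> has and every iterate inherits: only moves across the threshold
  \<open>v\<close> are visible from below.\<close>

definition constant_below :: "real \<Rightarrow> ('a \<Rightarrow> real) \<Rightarrow> bool" where
  "constant_below v f \<longleftrightarrow> (\<forall>x\<in>supp_on X \<pi>. \<forall>y\<in>supp_on X \<pi>. w x \<le> v \<longrightarrow> w y \<le> v \<longrightarrow> f x = f y)"

text \<open>
  Couple two chains through a common proposal and a common uniform variable: if only the chain
  with the smaller weight accepts, it lands below the weight at which the other one stays.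
\<close>

lemma weight_monotone_imh_op:
  assumes f: "unit_valued_on X f" and mono: "weight_monotone f"
  shows "weight_monotone (T f)"
  unfolding weight_monotone_def
proof (intro ballI impI)
  fix x z assume x: "x \<in> supp_on X \<pi>" and z: "z \<in> supp_on X \<pi>" and le: "w x \<le> w z"
  have X: "x \<in> X" "z \<in> X" and pos: "0 < w x" "0 < w z"
    using x z weight_pos_iff by (auto simp: supp_on_def)
  let ?a = "imh_accept \<pi> p x" and ?b = "imh_accept \<pi> p z"
  show "T f x \<le> T f z"
    unfolding imh_op_def
  proof (intro integral_mono unit_valued_integrable(1)[OF f] X)
    fix y assume "y \<in> space (leb_on X)"
    then have y: "y \<in> X" by simp
    have ba: "?b y \<le> ?a y"
      using le pos weight_nonneg[OF y] unfolding imh_accept_def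
      by (intro min.mono divide_left_mono) auto
    have fxz: "f x \<le> f z" using mono x z le by (auto simp: weight_monotone_def)
    have "0 \<le> (?a y - ?b y) * (f z - f y)"
    proof (cases "?a y = ?b y")
      case False
      then have "?b y < 1" using ba accept_range[OF X(1) y] by auto
      then have "w y < w z" using pos by (auto simp: imh_accept_def min_def field_simps split: if_splits)
      moreover have "y \<in> supp_on X \<pi>"
        using False weight_pos_iff[OF y] weight_nonneg[OF y] by (cases "w y = 0") (auto simp: imh_accept_def)
      ultimately have "f y \<le> f z" using mono z by (auto simp: weight_monotone_def)
      then show ?thesis using ba by simp
    qed simp
    moreover have "0 \<le> (1 - ?a y) * (f z - f x)"
      using accept_range[OF X(1) y] fxz by simp
    \<comment> \<open>The difference of the two sides is the sum of the two nonnegative products: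
      the first stands for proposals that only the chain at \<open>x\<close> accepts, the second for
      those that neither accepts.\<close>
    ultimately have "?a y * f y + (1 - ?a y) * f x \<le> ?b y * f y + (1 - ?b y) * f z"
      by (simp add: algebra_simps)
    then show "(?a y * f y + (1 - ?a y) * f x) * p y \<le> (?b y * f y + (1 - ?b y) * f z) * p y"
      using nonneg[OF y] by (simp add: mult_right_mono)
  qed
qed

text \<open>From any two states of weight at most \<open>v\<close>, a proposal of weight 0 is
  rejected, one of positive weight at most \<open>v\<close> leaves the value unchanged, and one of
  weight above \<open>v\<close> is accepted with certainty. So the expected increments
  agree.\<close>

lemma constant_below_imh_op:
  assumes f: "unit_valued_on X f" and const: "constant_below v f"
  shows "constant_below v (T f)"
  unfolding constant_below_def
proof (intro ballI impI)
  fix x z assume x: "x \<in> supp_on X \<pi>" "w x \<le> v" and z: "z \<in> supp_on X \<pi>" "w z \<le> v"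
  have X: "x \<in> X" "z \<in> X" and pos: "0 < w x" "0 < w z"
    using x z weight_pos_iff by (auto simp: supp_on_def)
  have fxz: "f x = f z" using const x z unfolding constant_below_def by blast
  have "T f x - f z = T f z - f z"
    unfolding imh_op_diff(1)[OF f X(1)] imh_op_diff(1)[OF f X(2)]
  proof (intro Bochner_Integration.integral_cong refl)
    fix y assume "y \<in> space (leb_on X)"
    then have y: "y \<in> X" by simp
    have "imh_accept \<pi> p x y * (f y - f z) = imh_accept \<pi> p z y * (f y - f z)"
    proof -
      consider "w y = 0" | "y \<in> supp_on X \<pi>" "w y \<le> v" | "v < w y"
        using weight_pos_iff[OF y] weight_nonneg[OF y] by force
      then show ?thesis
      proof cases
        case 2
        then have "f y = f z" using const z unfolding constant_below_def by blast
        then show ?thesis by simp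
      next
        case 3
        then have "w y / w x \<ge> 1" "w y / w z \<ge> 1" using x z pos by auto
        then show ?thesis by (simp add: imh_accept_def)
      qed (simp add: imh_accept_def)
    qed
    then show "(imh_accept \<pi> p x y * (f y - f z) + (1 - imh_accept \<pi> p x y) * (f x - f z)) * p y =
        (imh_accept \<pi> p z y * (f y - f z) + (1 - imh_accept \<pi> p z y) * (f z - f z)) * p y"
      by (simp add: fxz)
  qed
  then show "T f x = T f z" by simp
qed

text \<open>Bound the increment at \<open>x\<close> by the integral of \<open>f y - f x\<close>
  against \<open>\<pi> y / v\<close>. Proposals of weight above \<open>v\<close> have
  \<open>p y \<le> \<pi> y / v\<close> and a nonnegative increment; for all others both integrands
  are 0.\<close>

lemma imh_op_gap:
  assumes f: "unit_valued_on X f" and mono: "weight_monotone f" and const: "constant_below v f"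
    and x: "x \<in> supp_on X \<pi>" "w x \<le> v"
  shows "(1 - 1 / v) * (mean f - f x) \<le> mean f - T f x"
proof -
  have xX: "x \<in> X" and pos: "0 < w x"
    using x weight_pos_iff by (auto simp: supp_on_def)
  have v: "0 < v" using pos x(2) by simp
  have "T f x - f x \<le> (\<integral>y. (f y - f x) * \<pi> y / v \<partial>leb_on X)"
    unfolding imh_op_diff(1)[OF f xX]
  proof (intro integral_mono imh_op_diff(2)[OF f xX] integrable_divide_zero mean_diff(2)[OF f])
    fix y assume "y \<in> space (leb_on X)"
    then have y: "y \<in> X" by simp
    consider "w y = 0" | "y \<in> supp_on X \<pi>" "w y \<le> v" | "y \<in> supp_on X \<pi>" "v < w y"
      using weight_pos_iff[OF y] weight_nonneg[OF y] by force
    then show "(imh_accept \<pi> p x y * (f y - f x) + (1 - imh_accept \<pi> p x y) * (f x - f x)) * p y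
        \<le> (f y - f x) * \<pi> y / v"
    proof cases
      case 1
      then show ?thesis using target_eq_weight_mult[OF y] by (simp add: imh_accept_def)
    next
      case 2
      then have "f y = f x" using const x unfolding constant_below_def by blast
      then show ?thesis by simp
    next
      case 3
      then have fxy: "f x \<le> f y" using mono x by (auto simp: weight_monotone_def)
      have "imh_accept \<pi> p x y * p y \<le> p y"
        using accept_range[OF xX y] nonneg[OF y] by (auto intro: mult_left_le_one_le)
      also have "p y \<le> \<pi> y / v"
        using 3 v target_eq_weight_mult[OF y] mult_right_mono[OF less_imp_le[OF 3(2)] nonneg(2)[OF y]]
        by (simp add: field_simps)
      finally have "imh_accept \<pi> p x y * p y * (f y - f x) \<le> \<pi> y / v * (f y - f x)"
        using fxy by (intro mult_right_mono) auto
      then show ?thesis by (simp add: mult_ac)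
    qed
  qed
  also have "\<dots> = (mean f - f x) / v"
    using mean_diff(1)[OF f] by simp
  finally show ?thesis by (simp add: algebra_simps diff_divide_distrib)
qed

text \<open>Monotonicity and constancy below \<open>v\<close> pass to all iterates and the mean is
  invariant, so the one-step bound iterates; \<open>1 \<le> v\<close> keeps the factor
  nonnegative.\<close>

lemma imh_op_funpow_gap:
  assumes f: "unit_valued_on X f" and mono: "weight_monotone f" and const: "constant_below v f"
    and x: "x \<in> supp_on X \<pi>" "w x \<le> v" and v: "1 \<le> v"
  shows "(1 - 1 / v) ^ n * (mean f - f x) \<le> mean f - (T ^^ n) f x"
proof (induction n)
  case (Suc n)
  have "weight_monotone ((T ^^ n) f)" "constant_below v ((T ^^ n) f)"
    by (induction n) (auto intro: mono const f weight_monotone_imh_op constant_below_imh_op unit_valued_imh_op_funpow)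
  from imh_op_gap[OF unit_valued_imh_op_funpow[OF f] this x]
  have "(1 - 1 / v) * (mean f - (T ^^ n) f x) \<le> mean f - (T ^^ Suc n) f x"
    by (simp add: mean_funpow[OF f])
  moreover have "(1 - 1 / v) * ((1 - 1 / v) ^ n * (mean f - f x)) \<le> (1 - 1 / v) * (mean f - (T ^^ n) f x)"
    using Suc v by (intro mult_left_mono) auto
  ultimately show ?case by (simp add: mult_ac)
qed simp

section \<open>Total variation bounds and the root limit\<close>

text \<open>Total variation is a supremum of deviations of iterated indicators. The contraction
  bounds them uniformly, which gives the upper estimate and also the boundedness needed to estimate
  the supremum from below by a single event.\<close>

lemma imh_tv_dist:
  assumes x: "x \<in> supp_on X \<pi>"
  shows imh_tv_dist_le: "tv_dist (imh_steps X \<pi> p n x) (law_on X \<pi>) \<le> (1 - 1 / wstar) ^ n"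
    and imh_tv_dist_ge: "A \<in> sets (leb_on X) \<Longrightarrow>
      \<bar>(T ^^ n) (indicator A) x - mean (indicator A)\<bar> \<le> tv_dist (imh_steps X \<pi> p n x) (law_on X \<pi>)"
proof -
  have xX: "x \<in> X" using x by (simp add: supp_on_def)
  have tv: "tv_dist (imh_steps X \<pi> p n x) (law_on X \<pi>) =
      (SUP A\<in>sets (leb_on X). \<bar>(T ^^ n) (indicator A) x - mean (indicator A)\<bar>)"
    unfolding tv_dist_def sets_imh_steps[OF xX]
    by (intro SUP_cong) (auto simp: measure_imh_steps[OF xX] measure_law_on)
  have le: "\<bar>(T ^^ n) (indicator A) x - mean (indicator A)\<bar> \<le> (1 - 1 / wstar) ^ n"
    if "A \<in> sets (leb_on X)" for A
    using imh_op_funpow_contraction[OF unit_valued_indicator[OF that] x] .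
  show "tv_dist (imh_steps X \<pi> p n x) (law_on X \<pi>) \<le> (1 - 1 / wstar) ^ n"
    unfolding tv using le by (intro cSUP_least) auto
  show "\<bar>(T ^^ n) (indicator A) x - mean (indicator A)\<bar> \<le> tv_dist (imh_steps X \<pi> p n x) (law_on X \<pi>)"
    if "A \<in> sets (leb_on X)"
    unfolding tv using le that by (intro cSUP_upper bdd_aboveI2[where M="(1 - 1 / wstar) ^ n"]) auto
qed

text \<open>Points are Lebesgue null. Hence the event \<open>{x}\<close> starts with deviation 1 at
  \<open>x\<close>, which the exact decay at maximal weight turns into a lower bound.\<close>

lemma mean_indicator_singleton:
  assumes "x \<in> X"
  shows "{x} \<in> sets (leb_on X)" "mean (indicator {x}) = 0"
proof -
  show "{x} \<in> sets (leb_on X)"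
    using X_borel assms by (simp add: leb_on_def sets_restrict_space_iff)
  have "AE y in lborel. y \<in> X \<longrightarrow> indicator {x} y * \<pi> y = 0"
    using AE_lborel_singleton[of x] by eventually_elim auto
  then have "AE y in leb_on X. indicator {x} y * \<pi> y = 0"
    by (simp add: AE_leb_on)
  then show "mean (indicator {x}) = 0"
    by (rule integral_eq_zero_AE)
qed

text \<open>By continuity \<open>B\<close> is relatively open, and \<open>0 < v\<close> places it
  inside the support of the target. There \<open>charged\<close> gives it positive Lebesgue measure,
  so the pointwise supremum of the weight is also an essential one.\<close>

lemma high_weight_set:
  assumes v: "0 < v" "v < wstar"
    and charged: "\<forall>U. openin (top_of_set X) U \<and> U \<subseteq> supp_on X \<pi> \<and> U \<noteq> {} \<longrightarrow> 0 < emeasure lborel U"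
  defines "B \<equiv> {y \<in> supp_on X p. v < w y}"
  shows "B \<in> sets (leb_on X)" "0 < mean (indicator B)"
proof -
  have cont: "continuous_on X \<pi>" "continuous_on X p"
    using dens_\<pi> dens_p by (auto simp: cont_prob_density_on_def)
  have "supp_on X p = X \<inter> p -` {0<..}" by (auto simp: supp_on_def)
  then have op: "openin (top_of_set X) (supp_on X p)"
    using continuous_openin_preimage_gen[OF cont(2)] by simp
  have "continuous_on (supp_on X p) w"
    unfolding imh_weight_def using cont
    by (intro continuous_intros) (auto simp: supp_on_def elim: continuous_on_subset)
  moreover have "B = supp_on X p \<inter> w -` {v<..}" by (auto simp: B_def)
  ultimately have "openin (top_of_set (supp_on X p)) B"
    using continuous_openin_preimage_gen[of "supp_on X p" w "{v<..}"] by simp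
  then have opB: "openin (top_of_set X) B" using op openin_trans by blast
  then obtain V where "open V" "B = X \<inter> V" by (auto simp: openin_open)
  then have B: "B \<in> sets borel" "B \<subseteq> X" using X_borel by auto
  then show sets: "B \<in> sets (leb_on X)"
    using X_borel by (simp add: leb_on_def sets_restrict_space_iff)
  \<comment> \<open>Nonemptiness is required before the supremum defining \<open>wstar\<close> can
    be approximated by weights.\<close>
  have "supp_on X p \<noteq> {}"
  proof
    assume "supp_on X p = {}"
    then have "integral\<^sup>L (leb_on X) p = (\<integral>y. 0 \<partial>leb_on X)"
      using nonneg by (intro Bochner_Integration.integral_cong) (force simp: supp_on_def)+
    then show False using integral_p by simp
  qed
  then have "B \<noteq> {}"
    using v(2) bdd unfolding imh_wstar_def B_def by (subst (asm) less_cSUP_iff) auto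
  moreover have Bsub: "B \<subseteq> supp_on X \<pi>"
    using v(1) B(2) weight_pos_iff by (force simp: B_def)
  ultimately have pos: "0 < emeasure lborel B" using charged opB by blast
  have nn: "AE y in leb_on X. 0 \<le> indicator B y * \<pi> y"
    using nonneg by (intro AE_I2) auto
  have "mean (indicator B) \<noteq> 0"
  proof
    assume "mean (indicator B) = 0"
    then have "AE y in leb_on X. indicator B y * \<pi> y = 0"
      using integral_nonneg_eq_0_iff_AE[OF unit_valued_integrable_\<pi>[OF unit_valued_indicator[OF sets]] nn]
      by simp
    then have "AE y in lborel. y \<in> X \<longrightarrow> indicator B y * \<pi> y = 0"
      by (simp add: AE_leb_on)
    then have "AE y in lborel. y \<notin> B"
      by eventually_elim (use Bsub in \<open>auto simp: supp_on_def\<close>)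
    then have "emeasure lborel B = 0"
      using B(1) by (subst (asm) AE_iff_measurable[of B]) auto
    then show False using pos by simp
  qed
  moreover have "0 \<le> mean (indicator B)" using nn by (rule integral_nonneg_AE)
  ultimately show "0 < mean (indicator B)" by simp
qed

text \<open>At maximal weight \<open>q\<close> is the full rate and \<open>c = 1\<close>, from the
  event \<open>{x}\<close>. Otherwise \<open>q = 1 - 1 / v\<close> for a threshold \<open>v\<close>
  near \<open>wstar\<close>, and \<open>c\<close> is the target mass of \<open>B\<close>.\<close>

lemma imh_tv_dist_geometric_lower:
  assumes x: "x \<in> supp_on X \<pi>" and r: "0 \<le> r" "r < 1 - 1 / wstar"
    and charged: "\<forall>U. openin (top_of_set X) U \<and> U \<subseteq> supp_on X \<pi> \<and> U \<noteq> {} \<longrightarrow> 0 < emeasure lborel U"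
  shows "\<exists>c>0. \<exists>q>r. \<forall>n. c * q ^ n \<le> tv_dist (imh_steps X \<pi> p n x) (law_on X \<pi>)"
proof (cases "w x = wstar")
  case True
  have xX: "x \<in> X" using x by (simp add: supp_on_def)
  note single = mean_indicator_singleton[OF xX]
  have "1 * (1 - 1 / wstar) ^ n \<le> tv_dist (imh_steps X \<pi> p n x) (law_on X \<pi>)" for n
    using imh_tv_dist_ge[OF x single(1), of n]
      imh_op_funpow_at_max_weight[OF unit_valued_indicator[OF single(1)] x True, of n]
    by (simp add: single(2))
  then show ?thesis using r(2) zero_less_one by blast
next
  case False
  then have wx: "w x < wstar" using x supp weight_le_wstar[of x] by auto
  have ws: "1 < wstar"
  proof (rule ccontr)
    assume "\<not> 1 < wstar"
    then have "wstar = 1" using wstar_ge_1 by simp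
    then show False using r by simp
  qed
  \<comment> \<open>The threshold must satisfy three demands: close enough to \<open>wstar\<close>
    for the rate to exceed \<open>r\<close>, above \<open>w x\<close> so that \<open>x\<close> is
    outside \<open>B\<close>, and above 1 so that the gap estimate iterates.\<close>
  have "((\<lambda>v. 1 - 1 / v) \<longlongrightarrow> 1 - 1 / wstar) (at_left wstar)"
    using ws by (auto intro!: tendsto_intros)
  then have "\<forall>\<^sub>F v in at_left wstar. r < 1 - 1 / v"
    using r(2) by (rule order_tendstoD)
  moreover have "\<forall>\<^sub>F v in at_left wstar. v \<in> {max 1 (w x)<..<wstar}"
    using wx ws by (intro eventually_at_left_real) simp
  ultimately have "\<forall>\<^sub>F v in at_left wstar. r < 1 - 1 / v \<and> v \<in> {max 1 (w x)<..<wstar}"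
    by (rule eventually_conj)
  then obtain v where v: "r < 1 - 1 / v" "1 < v" "w x < v" "v < wstar"
    using eventually_happens'[OF trivial_limit_at_left_real] by fastforce
  define B where "B = {y \<in> supp_on X p. v < w y}"
  have v0: "0 < v" using v(2) by simp
  have B: "B \<in> sets (leb_on X)" "0 < mean (indicator B)"
    using high_weight_set[OF v0 v(4) charged] by (simp_all add: B_def)
  note f = unit_valued_indicator[OF B(1)]
  have mono: "weight_monotone (indicator B)"
    using supp by (auto simp: weight_monotone_def B_def indicator_def)
  have const: "constant_below v (indicator B)"
    by (auto simp: constant_below_def B_def indicator_def)
  \<comment> \<open>The initial gap at \<open>x\<close> is therefore the whole target mass of
    \<open>B\<close>.\<close>
  have "x \<notin> B" using v(3) by (simp add: B_def)
  then have "mean (indicator B) * (1 - 1 / v) ^ n \<le> tv_dist (imh_steps X \<pi> p n x) (law_on X \<pi>)" for n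
    using imh_op_funpow_gap[OF f mono const x less_imp_le[OF v(3)] less_imp_le[OF v(2)], of n]
      imh_tv_dist_ge[OF x B(1), of n]
    by (simp add: mult.commute)
  then show ?thesis using B(2) v(1) by blast
qed

text \<open>The contraction bounds every root with positive index by the rate. From below, the
  geometric bound has rate beyond any \<open>r\<close> under the limit, and its constant disappears
  since \<open>root n c\<close> tends to 1.\<close>

lemma imh_tv_dist_root_tendsto:
  assumes x: "x \<in> supp_on X \<pi>"
    and charged: "\<forall>U. openin (top_of_set X) U \<and> U \<subseteq> supp_on X \<pi> \<and> U \<noteq> {} \<longrightarrow> 0 < emeasure lborel U"
  shows "(\<lambda>n. root n (tv_dist (imh_steps X \<pi> p n x) (law_on X \<pi>))) \<longlonglongrightarrow> 1 - 1 / wstar"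
proof -
  define tv where "tv n = tv_dist (imh_steps X \<pi> p n x) (law_on X \<pi>)" for n
  have rate: "0 \<le> 1 - 1 / wstar" using wstar_ge_1 by simp
  have tv0: "0 \<le> tv n" for n
    unfolding tv_def by (rule order_trans[OF abs_ge_zero imh_tv_dist_ge[OF x sets.empty_sets]])
  \<comment> \<open>\<open>root 0\<close> is constantly 0, so cancelling the power requires a
    positive index.\<close>
  have upper: "root n (tv n) \<le> 1 - 1 / wstar" if "0 < n" for n
    using real_root_le_mono[OF that imh_tv_dist_le[OF x, of n]] rate that
    by (simp add: tv_def real_root_power_cancel)
  have "(\<lambda>n. root n (tv n)) \<longlonglongrightarrow> 1 - 1 / wstar"
  proof (rule order_tendstoI)
    fix r assume r: "r < 1 - 1 / wstar"
    show "\<forall>\<^sub>F n in sequentially. r < root n (tv n)"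
    proof (cases "0 \<le> r")
      case True
      then obtain c q where cq: "0 < c" "r < q" "\<And>n. c * q ^ n \<le> tv n"
        using imh_tv_dist_geometric_lower[OF x True r charged] unfolding tv_def by blast
      have "(\<lambda>n. root n c * q) \<longlonglongrightarrow> 1 * q"
        by (intro tendsto_intros LIMSEQ_root_const cq)
      then have "\<forall>\<^sub>F n in sequentially. r < root n c * q"
        using cq(2) by (intro order_tendstoD(1)) auto
      then show ?thesis
        using eventually_gt_at_top[of 0]
      proof eventually_elim
        case (elim n)
        have "root n c * q = root n (c * q ^ n)"
          using elim(2) cq(2) True by (simp add: real_root_mult real_root_power_cancel)
        also have "\<dots> \<le> root n (tv n)"
          using elim(2) cq(3) by (intro real_root_le_mono)
        finally show ?case using elim(1) by simp
      qed
    next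
      \<comment> \<open>The geometric bound concerns nonnegative \<open>r\<close> only; a negative
        \<open>r\<close> lies below every root.\<close>
      case False
      then have "r < root n (tv n)" for n
        using tv0[of n] real_root_ge_zero[of "tv n" n] by linarith
      then show ?thesis by simp
    qed
  next
    fix r assume "1 - 1 / wstar < r"
    then show "\<forall>\<^sub>F n in sequentially. root n (tv n) < r"
      using upper by (intro eventually_mono[OF eventually_gt_at_top[of 0]]) (auto intro: le_less_trans)
  qed
  then show ?thesis by (simp add: tv_def)
qed

end

text \<open>The Polish property enters through \<open>polish_imp_borel\<close>.
  \<open>convergent a\<close> accompanies \<open>lim a = r\<close> because \<open>lim\<close> alone
  does not assert convergence; the lower and upper limits are taken in \<open>ereal\<close>, a
  complete lattice.\<close>

theorem theorem3:
  fixes X :: "'a::euclidean_space set" and \<pi> p :: "'a \<Rightarrow> real"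
  assumes polish: "polish_space (top_of_set X)"
    and target: "cont_prob_density_on X \<pi>"
    and proposal: "cont_prob_density_on X p"
    and supp: "supp_on X \<pi> \<subseteq> supp_on X p"
    and charged: "\<forall>U. openin (top_of_set X) U \<and> U \<subseteq> supp_on X \<pi> \<and> U \<noteq> {} \<longrightarrow> 0 < emeasure lborel U"
    and bdd: "bdd_above (imh_weight \<pi> p ` supp_on X p)"
    and cond:
      "((\<exists>xstar\<in>supp_on X p. imh_weight \<pi> p xstar = imh_wstar X \<pi> p)
          \<and> locally_lipschitz_on X p \<and> locally_lipschitz_on X \<pi>)
       \<or> ((\<exists>L. L-lipschitz_on X \<pi>) \<and> (\<exists>L. L-lipschitz_on (supp_on X p) (imh_weight \<pi> p))
          \<and> (\<exists>(xs :: nat \<Rightarrow> 'a) c0. c0 > 0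
               \<and> (\<forall>k. xs k \<in> X \<and> \<pi> (xs k) \<ge> c0)
               \<and> (\<lambda>k. imh_weight \<pi> p (xs k)) \<longlonglongrightarrow> imh_wstar X \<pi> p))"
  shows "\<forall>x\<in>supp_on X \<pi>.
     (let a = (\<lambda>n. root n (tv_dist (imh_steps X \<pi> p n x) (law_on X \<pi>)));
          r = 1 - 1 / imh_wstar X \<pi> p
      in convergent a \<and> lim a = r
         \<and> liminf (\<lambda>n. ereal (a n)) = ereal r
         \<and> limsup (\<lambda>n. ereal (a n)) = ereal r)"
proof
  have borel: "X \<in> sets borel" using polish by (rule polish_imp_borel)
  interpret imh_dominated X \<pi> p
    using borel target proposal supp bdd by unfold_locales
  fix x assume "x \<in> supp_on X \<pi>"
  from imh_tv_dist_root_tendsto[OF this charged]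
  have lim: "(\<lambda>n. root n (tv_dist (imh_steps X \<pi> p n x) (law_on X \<pi>))) \<longlonglongrightarrow> 1 - 1 / imh_wstar X \<pi> p" .
  then have elim: "(\<lambda>n. ereal (root n (tv_dist (imh_steps X \<pi> p n x) (law_on X \<pi>))))
      \<longlonglongrightarrow> ereal (1 - 1 / imh_wstar X \<pi> p)"
    by (rule tendsto_ereal)
  show "let a = (\<lambda>n. root n (tv_dist (imh_steps X \<pi> p n x) (law_on X \<pi>)));
          r = 1 - 1 / imh_wstar X \<pi> p
      in convergent a \<and> lim a = r
         \<and> liminf (\<lambda>n. ereal (a n)) = ereal r
         \<and> limsup (\<lambda>n. ereal (a n)) = ereal r"
    unfolding Let_def
    using lim limI[OF lim] lim_imp_Liminf[OF _ elim] lim_imp_Limsup[OF _ elim]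
    by (auto simp: convergent_def)
qed

end
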